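(* Let $n\ge 4$, let $G=(V,E)$ be a graph with $n$ nodes and planted bisection $V_1,V_2$, and let $G_1=G[V_1]$, $G_2=G[V_2]$, and $G_0=(V,E_0)$ with $E_0$ the set of edges of $G$ between $V_1$ and $V_2$. Let $G_1$ and $G_2$ be $d_{\mathrm{in}}$-regular, with $d_{\mathrm{in}}\in\{1,\dots,\frac n2-1\}$, and let $G_0$ be $d_{\mathrm{out}}$-regular, with $d_{\mathrm{out}}\in\{0,\dots,\frac n2\}$. Then the LP relaxation recovers the planted bisection if $$d_{\mathrm{in}}-d_{\mathrm{out}}\ge\frac n4 .$$
   Context: Graphs are finite, simple and undirected, with $V=\{1,\dots,n\}$. A bisection of $V$ is a partition of $V$ into two subsets of equal cardinality (so $n$ is even); a fixed bisection $V_1,V_2$ is called the planted bisection. $G[U]$ denotes the subgraph induced by $U$. The LP relaxation (metric relaxation of the minimum bisection problem) associated with $G$ is the following linear program in $x\in\mathbb R^{\binom n2}$, with coordinates $x_{ij}$, $1\le i<j\le n$, and the convention $x_{ji}:=x_{ij}$: $$\min\ \sum_{1\le i<j\le n}a_{ij}x_{ij}$$ subject to $x_{ij}\le x_{ik}+x_{jk}$ for all distinct $i,j,k\in\{1,\dots,n\}$ with $i<j$; $x_{ij}+x_{ik}+x_{jk}\le 2$ for all $1\le i<j<k\le n$; and $\sum_{1\le i<j\le n}x_{ij}=n^2/4$. Here $a_{ij}=1$ if $\{i,j\}\in E$ and $a_{ij}=0$ otherwise. The cut vector corresponding to the planted bisection is $\bar x\in\{0,1\}^{\binom n2}$ with $\bar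 x_{ij}=0$ if $i,j$ are in the same set of the bisection and $\bar x_{ij}=1$ otherwise. The LP relaxation recovers the planted bisection if $\bar x$ is its unique optimal solution. *)

theory Defs
  imports Complex_Main "HOL-Library.FuncSet"
begin

definition simple_graph :: "'a set \<Rightarrow> 'a set set \<Rightarrow> bool" where
  "simple_graph V E \<longleftrightarrow> finite V \<and> (\<forall>e\<in>E. e \<subseteq> V \<and> card e = 2)"

definition degree :: "'a set set \<Rightarrow> 'a \<Rightarrow> nat" where
  "degree E v = card {e \<in> E. v \<in> e}"

definition regular_graph :: "'a set \<Rightarrow> 'a set set \<Rightarrow> nat \<Rightarrow> bool" where
  "regular_graph V E d \<longleftrightarrow> simple_graph V E \<and> (\<forall>v\<in>V. degree E v = d)"

definition induced_edges :: "'a set set \<Rightarrow> 'a set \<Rightarrow> 'a set set" where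
  "induced_edges E U = {e \<in> E. e \<subseteq> U}"

definition edges_between :: "'a set set \<Rightarrow> 'a set \<Rightarrow> 'a set \<Rightarrow> 'a set set" where
  "edges_between E U W = {e \<in> E. \<exists>u\<in>U. \<exists>w\<in>W. e = {u, w}}"

definition bisection :: "'a set \<Rightarrow> 'a set \<Rightarrow> 'a set \<Rightarrow> bool" where
  "bisection V V1 V2 \<longleftrightarrow> V1 \<union> V2 = V \<and> V1 \<inter> V2 = {} \<and> card V1 = card V2"

definition pairs :: "nat \<Rightarrow> (nat \<times> nat) set" where
  "pairs n = {(i, j). 1 \<le> i \<and> i < j \<and> j \<le> n}"

text \<open>
  The space of real vectors indexed by pairs is rendered as the extensional functions on
  \<^term>\<open>pairs n\<close>: values off the index set are fixed to \<^term>\<open>undefined\<close>, so that equality of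
  functions is equality of vectors.
\<close>

definition pair_vectors :: "nat \<Rightarrow> (nat \<times> nat \<Rightarrow> real) set" where
  "pair_vectors n = pairs n \<rightarrow>\<^sub>E UNIV"

text \<open>This implements the convention that the coordinates ji and ij coincide.\<close>

definition coord :: "(nat \<times> nat \<Rightarrow> real) \<Rightarrow> nat \<Rightarrow> nat \<Rightarrow> real" where
  "coord x i j = (if i < j then x (i, j) else x (j, i))"

definition lp_feasible :: "nat \<Rightarrow> (nat \<times> nat \<Rightarrow> real) \<Rightarrow> bool" where
  "lp_feasible n x \<longleftrightarrow>
     x \<in> pair_vectors n \<and>
     (\<forall>i\<in>{1..n}. \<forall>j\<in>{1..n}. \<forall>k\<in>{1..n}. i < j \<and> k \<noteq> i \<and> k \<noteq> j \<longrightarrow>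
        coord x i j \<le> coord x i k + coord x j k) \<and>
     (\<forall>i\<in>{1..n}. \<forall>j\<in>{1..n}. \<forall>k\<in>{1..n}. i < j \<and> j < k \<longrightarrow>
        coord x i j + coord x i k + coord x j k \<le> 2) \<and>
     (\<Sum>(i, j)\<in>pairs n. coord x i j) = (real n)\<^sup>2 / 4"

definition lp_objective :: "nat \<Rightarrow> nat set set \<Rightarrow> (nat \<times> nat \<Rightarrow> real) \<Rightarrow> real" where
  "lp_objective n E x = (\<Sum>(i, j)\<in>pairs n. (if {i, j} \<in> E then 1 else 0) * coord x i j)"

definition lp_optimal :: "nat \<Rightarrow> nat set set \<Rightarrow> (nat \<times> nat \<Rightarrow> real) \<Rightarrow> bool" where
  "lp_optimal n E x \<longleftrightarrow> is_arg_min (lp_objective n E) (lp_feasible n) x"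

definition cut_vector :: "nat \<Rightarrow> nat set \<Rightarrow> nat set \<Rightarrow> nat \<times> nat \<Rightarrow> real" where
  "cut_vector n V1 V2 =
     (\<lambda>(i, j)\<in>pairs n. if i \<in> V1 \<and> j \<in> V1 \<or> i \<in> V2 \<and> j \<in> V2 then 0 else 1)"

definition lp_recovers :: "nat \<Rightarrow> nat set set \<Rightarrow> nat set \<Rightarrow> nat set \<Rightarrow> bool" where
  "lp_recovers n E V1 V2 \<longleftrightarrow> (\<forall>x. lp_optimal n E x \<longleftrightarrow> x = cut_vector n V1 V2)"

end

(* Reflecting a feasible point x at the planted cut (x on pairs inside a part, 1 - x across)
   gives a metric z; the bisection constraint says that z has the same mass inside the parts as
   across, say B. Put m = n/2. Averaging z i j \<le> z i k + z j k over all k of the opposite part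
   shows that the non-edges inside the parts carry at most 2(m - 1 - d_in) B / m. Averaging
   over all k of one part shows that the crossing edges carry at most 2 d_out B / m.
   The objective therefore exceeds that of the cut vector by at least
   2 (1 + d_in - d_out - m/2) B / m \<ge> 2 B / m, and B = 0 forces z = 0. *)
theory Submission
  imports Defs
begin

section \<open>Averaging triangle inequalities over a third vertex\<close>

text \<open>Summing the triangle inequality over all \<open>k\<close> in \<open>Q\<close> bounds
  \<open>card Q * z i j\<close> by the row sums of \<open>i\<close> and \<open>j\<close> over
  \<open>Q\<close>. Since \<open>w\<close> has constant row and column sums, each such row sum is
  then counted with total weight \<open>d\<close>.\<close>

lemma weighted_triangle_sum:
  fixes z w :: "'a \<Rightarrow> 'a \<Rightarrow> real"
  assumes nonneg: "\<And>i j. i \<in> P \<Longrightarrow> j \<in> S \<Longrightarrow> w i j \<ge> 0"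
    and triangle: "\<And>i j k. i \<in> P \<Longrightarrow> j \<in> S \<Longrightarrow> k \<in> Q \<Longrightarrow> z i j \<le> z i k + z j k"
    and row: "\<And>i. i \<in> P \<Longrightarrow> (\<Sum>j\<in>S. w i j) = d"
    and col: "\<And>j. j \<in> S \<Longrightarrow> (\<Sum>i\<in>P. w i j) = d"
  shows "real (card Q) * (\<Sum>i\<in>P. \<Sum>j\<in>S. w i j * z i j)
           \<le> d * ((\<Sum>i\<in>P. \<Sum>k\<in>Q. z i k) + (\<Sum>j\<in>S. \<Sum>k\<in>Q. z j k))"
proof -
  define R where "R i = (\<Sum>k\<in>Q. z i k)" for i
  have pointwise: "real (card Q) * z i j \<le> R i + R j" if "i \<in> P" "j \<in> S" for i j
  proof -
    have "real (card Q) * z i j = (\<Sum>k\<in>Q. z i j)"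
      by simp
    also have "\<dots> \<le> (\<Sum>k\<in>Q. z i k + z j k)"
      using triangle that by (intro sum_mono) auto
    finally show ?thesis
      by (simp add: R_def sum.distrib)
  qed
  have "real (card Q) * (\<Sum>i\<in>P. \<Sum>j\<in>S. w i j * z i j)
          = (\<Sum>i\<in>P. \<Sum>j\<in>S. w i j * (real (card Q) * z i j))"
    by (simp add: sum_distrib_left algebra_simps)
  also have "\<dots> \<le> (\<Sum>i\<in>P. \<Sum>j\<in>S. w i j * (R i + R j))"
    using pointwise nonneg by (intro sum_mono mult_left_mono) auto
  also have "\<dots> = (\<Sum>i\<in>P. \<Sum>j\<in>S. w i j * R i) + (\<Sum>j\<in>S. \<Sum>i\<in>P. w i j * R j)"
    by (simp add: distrib_left sum.distrib sum.swap[of _ S P])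
  also have "(\<Sum>i\<in>P. \<Sum>j\<in>S. w i j * R i) = (\<Sum>i\<in>P. d * R i)"
    using row by (intro sum.cong) (auto simp flip: sum_distrib_right)
  also have "(\<Sum>j\<in>S. \<Sum>i\<in>P. w i j * R j) = (\<Sum>j\<in>S. d * R j)"
    using col by (intro sum.cong) (auto simp flip: sum_distrib_right)
  finally show ?thesis
    by (simp add: R_def distrib_left sum_distrib_left)
qed

text \<open>An upper bound on the non-edges inside \<open>P\<close>, routed through
  \<open>Q\<close>, is a lower bound on the edges. Every vertex has \<open>card P - 1 - d\<close>
  non-neighbours besides itself; the factor 2 arises because both endpoints of a pair range over
  \<open>P\<close>.\<close>

lemma inner_edge_sum_ge:
  fixes z :: "'a \<Rightarrow> 'a \<Rightarrow> real"
  assumes fin: "finite P"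
    and refl: "\<And>i. i \<in> P \<Longrightarrow> z i i = 0"
    and triangle: "\<And>i j k. i \<in> P \<Longrightarrow> j \<in> P \<Longrightarrow> k \<in> Q \<Longrightarrow> z i j \<le> z i k + z j k"
    and sym: "\<And>i j. adj i j \<longleftrightarrow> adj j i" and irrefl: "\<And>i. \<not> adj i i"
    and deg: "\<And>i. i \<in> P \<Longrightarrow> card {j \<in> P. adj i j} = d"
  shows "real (card Q) * (\<Sum>i\<in>P. \<Sum>j\<in>P. of_bool (adj i j) * z i j)
           \<ge> real (card Q) * (\<Sum>i\<in>P. \<Sum>j\<in>P. z i j)
              - 2 * (real (card P) - 1 - real d) * (\<Sum>i\<in>P. \<Sum>k\<in>Q. z i k)"
proof -
  \<comment> \<open>Indicator of the distinct non-adjacent pairs. Removing the diagonal is what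
    lowers the row sum by 1, the source of strictness in \<open>metric_gap\<close>.\<close>
  define w :: "'a \<Rightarrow> 'a \<Rightarrow> real" where "w i j = 1 - of_bool (adj i j) - of_bool (i = j)" for i j
  have row: "(\<Sum>j\<in>P. w i j) = real (card P) - 1 - real d" if "i \<in> P" for i
  proof -
    have "(\<Sum>j\<in>P. of_bool (adj i j)) = real d"
      using deg[OF that] fin by (simp add: of_bool_def sum.If_cases Int_def)
    moreover have "(\<Sum>j\<in>P. of_bool (i = j)) = (1 :: real)"
      using that fin by (simp add: of_bool_def)
    ultimately show ?thesis
      by (simp add: w_def sum_subtractf)
  qed
  have w_sym: "w i j = w j i" for i j
    by (auto simp: w_def sym)
  have "real (card Q) * (\<Sum>i\<in>P. \<Sum>j\<in>P. w i j * z i j)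
          \<le> (real (card P) - 1 - real d) * ((\<Sum>i\<in>P. \<Sum>k\<in>Q. z i k) + (\<Sum>j\<in>P. \<Sum>k\<in>Q. z j k))"
  proof (rule weighted_triangle_sum)
    show "w i j \<ge> 0" for i j
      by (cases "i = j") (auto simp: w_def irrefl)
    show "(\<Sum>i\<in>P. w i j) = real (card P) - 1 - real d" if "j \<in> P" for j
      using row[OF that] by (simp add: w_sym[of _ j])
  qed (use triangle row in auto)
  moreover have "(\<Sum>i\<in>P. \<Sum>j\<in>P. w i j * z i j)
      = (\<Sum>i\<in>P. \<Sum>j\<in>P. z i j - of_bool (adj i j) * z i j)"
    using refl irrefl by (intro sum.cong) (auto simp: w_def)
  ultimately show ?thesis
    by (simp add: sum_subtractf algebra_simps)
qed

text \<open>The intermediate vertex ranges over \<open>P\<close>, so a path from \<open>i\<close> to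
  \<open>j\<close> has one leg inside \<open>P\<close> and one leg across. This is why both kinds of
  mass appear on the right.\<close>

lemma cross_edge_sum_le:
  fixes z :: "'a \<Rightarrow> 'a \<Rightarrow> real"
  assumes fin: "finite P" "finite Q"
    and z_sym: "\<And>i j. z i j = z j i"
    and triangle: "\<And>i j k. i \<in> P \<Longrightarrow> j \<in> Q \<Longrightarrow> k \<in> P \<Longrightarrow> z i j \<le> z i k + z j k"
    and sym: "\<And>i j. adj i j \<longleftrightarrow> adj j i"
    and degP: "\<And>i. i \<in> P \<Longrightarrow> card {j \<in> Q. adj i j} = d"
    and degQ: "\<And>i. i \<in> Q \<Longrightarrow> card {j \<in> P. adj i j} = d"
  shows "real (card P) * (\<Sum>i\<in>P. \<Sum>j\<in>Q. of_bool (adj i j) * z i j)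
           \<le> real d * ((\<Sum>i\<in>P. \<Sum>j\<in>P. z i j) + (\<Sum>i\<in>P. \<Sum>j\<in>Q. z i j))"
proof -
  have "real (card P) * (\<Sum>i\<in>P. \<Sum>j\<in>Q. of_bool (adj i j) * z i j)
           \<le> real d * ((\<Sum>i\<in>P. \<Sum>k\<in>P. z i k) + (\<Sum>j\<in>Q. \<Sum>k\<in>P. z j k))"
  proof (rule weighted_triangle_sum)
    show "(\<Sum>j\<in>Q. of_bool (adj i j)) = real d" if "i \<in> P" for i
      using degP[OF that] fin by (simp add: of_bool_def sum.If_cases Int_def)
    show "(\<Sum>i\<in>P. of_bool (adj i j)) = real d" if "j \<in> Q" for j
      using degQ[OF that] fin by (simp add: of_bool_def sum.If_cases Int_def sym[of _ j])
  qed (use triangle in auto)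
  also have "(\<Sum>j\<in>Q. \<Sum>k\<in>P. z j k) = (\<Sum>i\<in>P. \<Sum>j\<in>Q. z i j)"
    by (subst sum.swap) (simp add: z_sym)
  finally show ?thesis .
qed

text \<open>Neither part's inner mass is known on its own. Each averaging bound is therefore used
  for both parts, and the results are added so that only the total inner mass occurs, which
  \<open>balance\<close> equates with twice the crossing mass.\<close>

lemma metric_gap:
  fixes z :: "'a \<Rightarrow> 'a \<Rightarrow> real"
  assumes fin: "finite P" "finite Q" and card: "card P = m" "card Q = m"
    and z_refl: "\<And>i. z i i = 0" and z_sym: "\<And>i j. z i j = z j i"
    and nonneg: "\<And>i j. i \<in> P \<union> Q \<Longrightarrow> j \<in> P \<union> Q \<Longrightarrow> z i j \<ge> 0"
    and triangle: "\<And>i j k. i \<in> P \<union> Q \<Longrightarrow> j \<in> P \<union> Q \<Longrightarrow> k \<in> P \<union> Q \<Longrightarrow> z i j \<le> z i k + z j k"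
    and sym: "\<And>i j. adj i j \<longleftrightarrow> adj j i" and irrefl: "\<And>i. \<not> adj i i"
    and inP: "\<And>i. i \<in> P \<Longrightarrow> card {j \<in> P. adj i j} = d"
    and inQ: "\<And>i. i \<in> Q \<Longrightarrow> card {j \<in> Q. adj i j} = d"
    and outP: "\<And>i. i \<in> P \<Longrightarrow> card {j \<in> Q. adj i j} = e"
    and outQ: "\<And>i. i \<in> Q \<Longrightarrow> card {j \<in> P. adj i j} = e"
    and balance: "(\<Sum>i\<in>P. \<Sum>j\<in>P. z i j) + (\<Sum>i\<in>Q. \<Sum>j\<in>Q. z i j) = 2 * (\<Sum>i\<in>P. \<Sum>j\<in>Q. z i j)"
    and degrees: "real d - real e \<ge> real m / 2"
  shows "4 * (\<Sum>i\<in>P. \<Sum>j\<in>Q. z i j)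
    \<le> real m * ((\<Sum>i\<in>P. \<Sum>j\<in>P. of_bool (adj i j) * z i j)
          + (\<Sum>i\<in>Q. \<Sum>j\<in>Q. of_bool (adj i j) * z i j)
          - 2 * (\<Sum>i\<in>P. \<Sum>j\<in>Q. of_bool (adj i j) * z i j))"
proof -
  let ?w = "\<lambda>i j. of_bool (adj i j) * z i j"
  define B where "B = (\<Sum>i\<in>P. \<Sum>j\<in>Q. z i j)"
  define AP where "AP = (\<Sum>i\<in>P. \<Sum>j\<in>P. z i j)"
  define AQ where "AQ = (\<Sum>i\<in>Q. \<Sum>j\<in>Q. z i j)"
  define aP where "aP = (\<Sum>i\<in>P. \<Sum>j\<in>P. ?w i j)"
  define aQ where "aQ = (\<Sum>i\<in>Q. \<Sum>j\<in>Q. ?w i j)"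
  define b where "b = (\<Sum>i\<in>P. \<Sum>j\<in>Q. ?w i j)"
  have B': "(\<Sum>i\<in>Q. \<Sum>j\<in>P. z i j) = B"
    unfolding B_def by (subst sum.swap) (simp add: z_sym)
  have b': "(\<Sum>i\<in>Q. \<Sum>j\<in>P. ?w i j) = b"
    unfolding b_def by (subst sum.swap) (simp add: z_sym sym)
  have "real (card Q) * aP \<ge> real (card Q) * AP - 2 * (real (card P) - 1 - real d) * B"
    unfolding aP_def AP_def B_def
    by (rule inner_edge_sum_ge) (use fin z_refl triangle sym irrefl inP in auto)
  moreover have "real (card P) * aQ \<ge> real (card P) * AQ
      - 2 * (real (card Q) - 1 - real d) * (\<Sum>i\<in>Q. \<Sum>j\<in>P. z i j)"
    unfolding aQ_def AQ_def
    by (rule inner_edge_sum_ge) (use fin z_refl triangle sym irrefl inQ in auto)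
  moreover have "real (card P) * b \<le> real e * (AP + B)"
    unfolding b_def AP_def B_def
    by (rule cross_edge_sum_le) (use fin z_sym triangle sym outP outQ in auto)
  \<comment> \<open>The same crossing edges are bounded a second time, now with intermediate
    vertices in \<open>Q\<close>.\<close>
  moreover have "real (card Q) * (\<Sum>i\<in>Q. \<Sum>j\<in>P. ?w i j)
      \<le> real e * (AQ + (\<Sum>i\<in>Q. \<Sum>j\<in>P. z i j))"
    unfolding AQ_def
    by (rule cross_edge_sum_le) (use fin z_sym triangle sym outP outQ in auto)
  ultimately have
    "real m * (aP + aQ) \<ge> real m * (AP + AQ) - 4 * (real m - 1 - real d) * B"
    "2 * (real m * b) \<le> real e * (AP + AQ + 2 * B)"
    unfolding card B' b' by (auto simp: algebra_simps)
  moreover have "AP + AQ = 2 * B"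
    using balance by (simp add: AP_def AQ_def B_def)
  ultimately have "real m * (aP + aQ - 2 * b)
      \<ge> real m * (2 * B) - 4 * (real m - 1 - real d) * B - real e * (4 * B)"
    by (simp add: algebra_simps)
  \<comment> \<open>The surplus \<open>4 * B\<close> stems from the \<open>- 1\<close> in the count
    of non-neighbours, so it survives even when \<open>degrees\<close> holds with equality.\<close>
  moreover have "real m * (2 * B) - 4 * (real m - 1 - real d) * B - real e * (4 * B)
      = 4 * B + 4 * (real d - real e - real m / 2) * B"
    by (simp add: algebra_simps)
  moreover have "B \<ge> 0"
    unfolding B_def using nonneg by (intro sum_nonneg) auto
  then have "4 * (real d - real e - real m / 2) * B \<ge> 0"
    using degrees by (intro mult_nonneg_nonneg) auto
  ultimately show ?thesis
    by (simp add: B_def aP_def aQ_def b_def)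
qed

section \<open>Degrees and symmetric double sums\<close>

text \<open>An edge at \<open>v\<close> corresponds to its other endpoint; \<open>j = v\<close>
  contributes nothing because edges have exactly two elements.\<close>

lemma degree_eq_card_neighbours:
  assumes "simple_graph V E"
  shows "degree E v = card {j \<in> V. {v, j} \<in> E}"
proof -
  have "bij_betw (\<lambda>j. {v, j}) {j \<in> V. {v, j} \<in> E} {e \<in> E. v \<in> e}"
  proof (rule bij_betw_imageI)
    show "inj_on (\<lambda>j. {v, j}) {j \<in> V. {v, j} \<in> E}"
      by (auto simp: inj_on_def doubleton_eq_iff)
    show "(\<lambda>j. {v, j}) ` {j \<in> V. {v, j} \<in> E} = {e \<in> E. v \<in> e}"
    proof (intro equalityI subsetI)
      fix e assume e: "e \<in> {e \<in> E. v \<in> e}"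
      then have "card e = 2" "e \<subseteq> V"
        using assms by (auto simp: simple_graph_def)
      then obtain j where "e = {v, j}"
        using e by (auto simp: card_2_iff)
      with e \<open>e \<subseteq> V\<close> show "e \<in> (\<lambda>j. {v, j}) ` {j \<in> V. {v, j} \<in> E}"
        by auto
    qed auto
  qed
  then show ?thesis
    by (simp add: degree_def bij_betw_same_card)
qed

text \<open>The square splits into \<open>pairs n\<close>, its mirror image and the diagonal. This
  turns sums over ordered index pairs of the LP into double sums, which can be split along the
  bisection.\<close>

lemma sum_pairs_symmetric:
  fixes f :: "nat \<Rightarrow> nat \<Rightarrow> real"
  assumes sym: "\<And>i j. f i j = f j i" and diag: "\<And>i. f i i = 0"
  shows "(\<Sum>i\<in>{1..n}. \<Sum>j\<in>{1..n}. f i j) = 2 * (\<Sum>(i, j)\<in>pairs n. f i j)"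
proof -
  have pairs_sub: "pairs n \<subseteq> {1..n} \<times> {1..n}"
    by (auto simp: pairs_def)
  then have fin: "finite (pairs n)"
    by (rule finite_subset) auto
  have disj: "pairs n \<inter> prod.swap ` pairs n = {}"
    by (auto simp: pairs_def)
  have "(\<Sum>i\<in>{1..n}. \<Sum>j\<in>{1..n}. f i j) = (\<Sum>(i, j)\<in>{1..n} \<times> {1..n}. f i j)"
    by (simp add: sum.cartesian_product)
  also have "\<dots> = (\<Sum>(i, j)\<in>pairs n \<union> prod.swap ` pairs n. f i j)"
  proof (rule sum.mono_neutral_right)
    show "\<forall>p\<in>{1..n} \<times> {1..n} - (pairs n \<union> prod.swap ` pairs n). (case p of (i, j) \<Rightarrow> f i j) = 0"
    proof
      fix p assume p: "p \<in> {1..n} \<times> {1..n} - (pairs n \<union> prod.swap ` pairs n)"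
      obtain i j where ij: "p = (i, j)"
        by fastforce
      have "(j, i) \<notin> pairs n"
        using p ij by force
      then have "i = j"
        using p ij by (auto simp: pairs_def)
      then show "(case p of (i, j) \<Rightarrow> f i j) = 0"
        by (simp add: ij diag)
    qed
  qed (use pairs_sub in auto)
  also have "\<dots> = (\<Sum>(i, j)\<in>pairs n. f i j) + (\<Sum>(i, j)\<in>prod.swap ` pairs n. f i j)"
    using fin disj by (intro sum.union_disjoint) auto
  also have "(\<Sum>(i, j)\<in>prod.swap ` pairs n. f i j) = (\<Sum>(i, j)\<in>pairs n. f i j)"
    by (subst sum.reindex) (auto intro!: sum.cong simp: sym)
  finally show ?thesis
    by simp
qed

lemma double_sum_union:
  fixes f :: "'a \<Rightarrow> 'a \<Rightarrow> real"
  assumes "finite P" "finite Q" "P \<inter> Q = {}" and sym: "\<And>i j. f i j = f j i"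
  shows "(\<Sum>i\<in>P \<union> Q. \<Sum>j\<in>P \<union> Q. f i j)
     = (\<Sum>i\<in>P. \<Sum>j\<in>P. f i j) + (\<Sum>i\<in>Q. \<Sum>j\<in>Q. f i j) + 2 * (\<Sum>i\<in>P. \<Sum>j\<in>Q. f i j)"
proof -
  have "(\<Sum>i\<in>Q. \<Sum>j\<in>P. f i j) = (\<Sum>i\<in>P. \<Sum>j\<in>Q. f i j)"
    by (subst sum.swap) (simp add: sym)
  then show ?thesis
    using assms by (simp add: sum.union_disjoint sum.distrib)
qed

section \<open>LP constraints without index order, and the cut vector\<close>

lemma coord_commute: "i \<noteq> j \<Longrightarrow> coord x i j = coord x j i"
  by (auto simp: coord_def)

lemma lp_feasible_triangle:
  assumes "lp_feasible n x" "{i, j, k} \<subseteq> {1..n}" "i \<noteq> j" "i \<noteq> k" "j \<noteq> k"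
  shows "coord x i j \<le> coord x i k + coord x j k"
proof (cases "i < j")
  case True
  then show ?thesis
    using assms unfolding lp_feasible_def by auto
next
  case False
  then have "coord x j i \<le> coord x j k + coord x i k"
    using assms unfolding lp_feasible_def by auto
  then show ?thesis
    using coord_commute[of i j] assms by simp
qed

lemma lp_feasible_perimeter:
  assumes "lp_feasible n x" "{i, j, k} \<subseteq> {1..n}" "i \<noteq> j" "i \<noteq> k" "j \<noteq> k"
  shows "coord x i j + coord x i k + coord x j k \<le> 2"
proof -
  have ordered: "coord x i j + coord x i k + coord x j k \<le> 2"
    if "{i, j, k} \<subseteq> {1..n}" "i < j" "j < k" for i j k
    using assms(1) that unfolding lp_feasible_def by auto
  consider "i < j" "j < k" | "i < k" "k < j" | "j < i" "i < k" | "j < k" "k < i"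
    | "k < i" "i < j" | "k < j" "j < i"
    using assms by linarith
  then show ?thesis
    using ordered[of i j k] ordered[of i k j] ordered[of j i k] ordered[of j k i]
      ordered[of k i j] ordered[of k j i] assms
      coord_commute[of i j x] coord_commute[of i k x] coord_commute[of j k x]
    by cases auto
qed

lemma coord_cut_vector:
  assumes "i \<in> {1..n}" "j \<in> {1..n}" "i \<noteq> j" "V1 \<inter> V2 = {}" "V1 \<union> V2 = {1..n}"
  shows "coord (cut_vector n V1 V2) i j = of_bool ((i \<in> V1) \<noteq> (j \<in> V1))"
proof -
  have "coord (cut_vector n V1 V2) i j
      = (if i \<in> V1 \<and> j \<in> V1 \<or> i \<in> V2 \<and> j \<in> V2 then 0 else 1)"
    using assms(1-3) by (auto simp: coord_def cut_vector_def pairs_def)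
  then show ?thesis
    using assms by auto
qed

text \<open>Among three vertices divided into two classes, the number of separated pairs is 0 or 2.
  This yields both the triangle and the perimeter constraints.\<close>

lemma lp_feasible_cut_vector:
  assumes "bisection {1..n} V1 V2"
  shows "lp_feasible n (cut_vector n V1 V2)"
proof -
  let ?c = "cut_vector n V1 V2"
  let ?f = "\<lambda>i j. of_bool ((i \<in> V1) \<noteq> (j \<in> V1)) :: real"
  have V: "V1 \<union> V2 = {1..n}" "V1 \<inter> V2 = {}" "card V1 = card V2"
    using assms by (auto simp: bisection_def)
  have fin: "finite V1" "finite V2"
    using V(1) by (metis finite_Un finite_atLeastAtMost)+
  have n: "real n = 2 * real (card V1)"
    using card_Un_disjoint[OF fin V(2)] V by simp
  have coord: "coord ?c i j = ?f i j" if "i \<in> {1..n}" "j \<in> {1..n}" "i \<noteq> j" for i j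
    using coord_cut_vector that V by blast
  have V2: "j \<notin> V1" if "j \<in> V2" for j
    using V that by auto
  have "2 * (\<Sum>(i, j)\<in>pairs n. coord ?c i j) = 2 * (\<Sum>(i, j)\<in>pairs n. ?f i j)"
    using coord by (intro arg_cong[of _ _ "\<lambda>t. 2 * t"] sum.cong) (auto simp: pairs_def)
  also have "\<dots> = (\<Sum>i\<in>V1 \<union> V2. \<Sum>j\<in>V1 \<union> V2. ?f i j)"
    unfolding V(1) by (rule sum_pairs_symmetric[symmetric]) auto
  also have "\<dots> = (\<Sum>i\<in>V1. \<Sum>j\<in>V1. ?f i j) + (\<Sum>i\<in>V2. \<Sum>j\<in>V2. ?f i j)
      + 2 * (\<Sum>i\<in>V1. \<Sum>j\<in>V2. ?f i j)"
    using fin V by (intro double_sum_union) auto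
  \<comment> \<open>Only the crossing sum is nonzero; it has \<open>card V1 * card V2\<close> terms
    equal to 1, that is, a quarter of the square of \<open>n\<close>.\<close>
  also have "\<dots> = 2 * (real n)\<^sup>2 / 4"
    using V2 V(3) n by (simp add: power2_eq_square)
  finally have total: "(\<Sum>(i, j)\<in>pairs n. coord ?c i j) = (real n)\<^sup>2 / 4"
    by simp
  have "?c \<in> pair_vectors n"
    by (auto simp: pair_vectors_def cut_vector_def)
  then show ?thesis
    unfolding lp_feasible_def using total coord by auto
qed

section \<open>Reflection of a feasible point at a cut\<close>

text \<open>This is the switching operation on the metric polytope; switching at \<open>V1\<close>
  sends the planted cut vector to zero. The diagonal is set explicitly because
  \<open>coord x i i\<close> reads \<open>x\<close> outside its index set.\<close>

definition reflected_metric :: "nat set \<Rightarrow> (nat \<times> nat \<Rightarrow> real) \<Rightarrow> nat \<Rightarrow> nat \<Rightarrow> real" where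
  "reflected_metric U x i j =
     (if i = j then 0 else if (i \<in> U) = (j \<in> U) then coord x i j else 1 - coord x i j)"

lemma reflected_metric_refl: "reflected_metric U x i i = 0"
  by (simp add: reflected_metric_def)

lemma reflected_metric_sym: "reflected_metric U x i j = reflected_metric U x j i"
  using coord_commute[of i j x] by (auto simp: reflected_metric_def)

text \<open>Switching permutes the three triangle inequalities and the perimeter inequality of a
  triple. If \<open>U\<close> separates \<open>k\<close> from \<open>i\<close> and \<open>j\<close>,
  the claim is the perimeter inequality; in the other cases it is one of the triangle
  inequalities.\<close>

lemma reflected_metric_triangle_distinct:
  assumes "lp_feasible n x" "{i, j, k} \<subseteq> {1..n}" "i \<noteq> j" "i \<noteq> k" "j \<noteq> k"
  shows "reflected_metric U x i j \<le> reflected_metric U x i k + reflected_metric U x j k"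
proof -
  have "coord x i j \<le> coord x i k + coord x j k"
    "coord x i k \<le> coord x i j + coord x j k"
    "coord x j k \<le> coord x i j + coord x i k"
    "coord x i j + coord x i k + coord x j k \<le> 2"
    using lp_feasible_triangle[OF assms(1), of i j k] lp_feasible_triangle[OF assms(1), of i k j]
      lp_feasible_triangle[OF assms(1), of j k i] lp_feasible_perimeter[OF assms]
      assms coord_commute[of i j x] coord_commute[of i k x] coord_commute[of j k x]
    by auto
  then show ?thesis
    using assms(3-5) by (auto simp: reflected_metric_def)
qed

text \<open>The LP does not list nonnegativity. It follows by adding the triangle inequalities for
  \<open>z i k\<close> and \<open>z j k\<close> through \<open>j\<close> and \<open>i\<close>, where
  the third vertex \<open>k\<close> exists because \<open>n \<ge> 3\<close>.\<close>

lemma reflected_metric_nonneg: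
  assumes "lp_feasible n x" "n \<ge> 3" "i \<in> {1..n}" "j \<in> {1..n}"
  shows "reflected_metric U x i j \<ge> 0"
proof (cases "i = j")
  case False
  have "card {i, j} < card {1..n}"
    using assms(2) False by simp
  then have "\<not> {1..n} \<subseteq> {i, j}"
    using card_mono[of "{i, j}" "{1..n}"] by auto
  then obtain k where "k \<in> {1..n}" "k \<noteq> i" "k \<noteq> j"
    by blast
  then show ?thesis
    using reflected_metric_triangle_distinct[OF assms(1), of i k j U]
      reflected_metric_triangle_distinct[OF assms(1), of j k i U]
      reflected_metric_sym[of U x i j] reflected_metric_sym[of U x i k]
      reflected_metric_sym[of U x j k] False assms
    by auto
qed (simp add: reflected_metric_def)

text \<open>The averages also run over coinciding indices. The case \<open>i = j\<close> is
  nonnegativity; the cases with \<open>k\<close> equal to \<open>i\<close> or \<open>j\<close> hold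
  with equality.\<close>

lemma reflected_metric_triangle:
  assumes "lp_feasible n x" "n \<ge> 3" "i \<in> {1..n}" "j \<in> {1..n}" "k \<in> {1..n}"
  shows "reflected_metric U x i j \<le> reflected_metric U x i k + reflected_metric U x j k"
proof (cases "i = j \<or> i = k \<or> j = k")
  case True
  then show ?thesis
    using reflected_metric_nonneg[OF assms(1,2), of i k U] assms
      reflected_metric_sym[of U x i j] reflected_metric_refl[of U x]
    by auto
next
  case False
  then show ?thesis
    using reflected_metric_triangle_distinct[OF assms(1)] assms by simp
qed


section \<open>Recovery of the planted bisection\<close>

theorem proposition2:
  fixes n d_in d_out :: nat
    and V V1 V2 :: "nat set"
    and E :: "nat set set"
  assumes "n \<ge> 4"
    and "V = {1..n}"
    and "simple_graph V E"
    and "bisection V V1 V2"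
    and "d_in \<in> {1..n div 2 - 1}"
    and "d_out \<in> {0..n div 2}"
    and "regular_graph V1 (induced_edges E V1) d_in"
    and "regular_graph V2 (induced_edges E V2) d_in"
    and "regular_graph V (edges_between E V1 V2) d_out"
    and "real d_in - real d_out \<ge> real n / 4"
  shows "lp_recovers n E V1 V2"
proof -
  have V: "V1 \<union> V2 = {1..n}" "V1 \<inter> V2 = {}" "card V1 = card V2"
    using assms by (auto simp: bisection_def)
  have fin: "finite V1" "finite V2"
    using V(1) by (metis finite_Un finite_atLeastAtMost)+
  have n: "real n = 2 * real (card V1)"
    using card_Un_disjoint[OF fin V(2)] V by simp
  have V2: "j \<notin> V1" if "j \<in> V2" for j
    using V that by auto
  let ?c = "cut_vector n V1 V2"
  define adj where "adj i j \<longleftrightarrow> {i, j} \<in> E" for i j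
  have adj_sym: "adj i j \<longleftrightarrow> adj j i" for i j
    by (simp add: adj_def insert_commute)
  have adj_irrefl: "\<not> adj i i" for i
    using assms(3) by (auto simp: adj_def simple_graph_def)
  have inner_degree: "card {j \<in> U. adj i j} = d_in"
    if "regular_graph U (induced_edges E U) d_in" "i \<in> U" for U i
  proof -
    have "{j \<in> U. {i, j} \<in> induced_edges E U} = {j \<in> U. adj i j}"
      using that(2) by (auto simp: induced_edges_def adj_def)
    then show ?thesis
      using that degree_eq_card_neighbours[of U "induced_edges E U" i]
      by (simp add: regular_graph_def)
  qed
  have outer: "card {j \<in> V. {i, j} \<in> edges_between E V1 V2} = d_out" if "i \<in> V" for i
    using that assms(9) degree_eq_card_neighbours[of V "edges_between E V1 V2" i]
    by (simp add: regular_graph_def)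
  have out1: "card {j \<in> V2. adj i j} = d_out" if "i \<in> V1" for i
  proof -
    have "{j \<in> V. {i, j} \<in> edges_between E V1 V2} = {j \<in> V2. adj i j}"
      using that V assms(2) by (auto simp: edges_between_def adj_def doubleton_eq_iff)
    moreover have "i \<in> V"
      using that V(1) assms(2) by blast
    ultimately show ?thesis
      using outer by metis
  qed
  have out2: "card {j \<in> V1. adj i j} = d_out" if "i \<in> V2" for i
  proof -
    have "{j \<in> V. {i, j} \<in> edges_between E V1 V2} = {j \<in> V1. adj i j}"
      using that V assms(2)
      by (auto simp: edges_between_def adj_def doubleton_eq_iff insert_commute)
    moreover have "i \<in> V"
      using that V(1) assms(2) by blast
    ultimately show ?thesis
      using outer by metis
  qed
  have feasible_cut: "lp_feasible n ?c"
    using assms lp_feasible_cut_vector by simp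
  \<comment> \<open>Strictness against every other feasible point gives optimality and uniqueness at
    once.\<close>
  have strict: "lp_objective n E ?c < lp_objective n E x"
    if x: "lp_feasible n x" and neq: "x \<noteq> ?c" for x
  proof -
    define z where "z = reflected_metric V1 x"
    \<comment> \<open>The difference between \<open>x\<close> and the cut vector: inside a part the
      cut vector is 0, and across it is 1, which reverses the sign of \<open>z\<close>.\<close>
    define D where "D i j = (if (i \<in> V1) = (j \<in> V1) then z i j else - z i j)" for i j
    define B where "B = (\<Sum>i\<in>V1. \<Sum>j\<in>V2. z i j)"
    have z_sym: "z i j = z j i" for i j
      unfolding z_def by (rule reflected_metric_sym)
    have z_refl: "z i i = 0" for i
      unfolding z_def by (rule reflected_metric_refl)
    have nonneg: "z i j \<ge> 0" if "i \<in> {1..n}" "j \<in> {1..n}" for i j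
      unfolding z_def using reflected_metric_nonneg x that assms(1) by simp
    have D: "coord x i j - coord ?c i j = D i j" if "(i, j) \<in> pairs n" for i j
      using that coord_cut_vector[of i n j V1 V2] V
      by (auto simp: D_def z_def reflected_metric_def pairs_def)
    \<comment> \<open>Used with two weights: the constant 1 gives the balance equation, and
      adjacency gives the objective.\<close>
    have expand: "2 * (\<Sum>(i, j)\<in>pairs n. w i j * D i j)
        = (\<Sum>i\<in>V1. \<Sum>j\<in>V1. w i j * z i j) + (\<Sum>i\<in>V2. \<Sum>j\<in>V2. w i j * z i j)
          - 2 * (\<Sum>i\<in>V1. \<Sum>j\<in>V2. w i j * z i j)"
      if w: "\<And>i j. w i j = w j i" for w :: "nat \<Rightarrow> nat \<Rightarrow> real"
    proof -
      have wD_sym: "w i j * D i j = w j i * D j i" for i j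
        using w[of i j] z_sym[of i j] by (auto simp: D_def)
      have "2 * (\<Sum>(i, j)\<in>pairs n. w i j * D i j)
          = (\<Sum>i\<in>V1 \<union> V2. \<Sum>j\<in>V1 \<union> V2. w i j * D i j)"
        unfolding V(1)
        by (rule sum_pairs_symmetric[symmetric]) (use wD_sym z_refl in \<open>auto simp: D_def\<close>)
      also have "\<dots> = (\<Sum>i\<in>V1. \<Sum>j\<in>V1. w i j * D i j) + (\<Sum>i\<in>V2. \<Sum>j\<in>V2. w i j * D i j)
          + 2 * (\<Sum>i\<in>V1. \<Sum>j\<in>V2. w i j * D i j)"
        using fin V(2) wD_sym by (rule double_sum_union)
      finally show ?thesis
        by (simp add: D_def V2 sum_negf)
    qed
    have "(\<Sum>(i, j)\<in>pairs n. D i j)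
        = (\<Sum>(i, j)\<in>pairs n. coord x i j) - (\<Sum>(i, j)\<in>pairs n. coord ?c i j)"
      by (subst sum_subtractf[symmetric]) (auto intro!: sum.cong simp: D)
    also have "\<dots> = 0"
      using x feasible_cut by (simp add: lp_feasible_def)
    finally have balance:
      "(\<Sum>i\<in>V1. \<Sum>j\<in>V1. z i j) + (\<Sum>i\<in>V2. \<Sum>j\<in>V2. z i j) = 2 * (\<Sum>i\<in>V1. \<Sum>j\<in>V2. z i j)"
      using expand[of "\<lambda>i j. 1"] by simp
    have "lp_objective n E x - lp_objective n E ?c
        = (\<Sum>(i, j)\<in>pairs n. of_bool (adj i j) * D i j)"
      unfolding lp_objective_def
      by (subst sum_subtractf[symmetric]) (auto intro!: sum.cong simp: adj_def simp flip: D)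
    then have objective: "2 * (lp_objective n E x - lp_objective n E ?c)
        = (\<Sum>i\<in>V1. \<Sum>j\<in>V1. of_bool (adj i j) * z i j)
          + (\<Sum>i\<in>V2. \<Sum>j\<in>V2. of_bool (adj i j) * z i j)
          - 2 * (\<Sum>i\<in>V1. \<Sum>j\<in>V2. of_bool (adj i j) * z i j)"
      using expand[of "\<lambda>i j. of_bool (adj i j)"] adj_sym by simp
    have gap: "4 * B \<le> real (card V1) * (2 * (lp_objective n E x - lp_objective n E ?c))"
      unfolding objective B_def
    proof (rule metric_gap[where d = d_in and e = d_out])
      show "z i j \<le> z i k + z j k" if "i \<in> V1 \<union> V2" "j \<in> V1 \<union> V2" "k \<in> V1 \<union> V2" for i j k
        unfolding z_def using reflected_metric_triangle x that V(1) assms(1) by simp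
      \<comment> \<open>With parts of size \<open>n / 2\<close>, the threshold \<open>n / 4\<close>
        is half the size of a part.\<close>
      show "real d_in - real d_out \<ge> real (card V1) / 2"
        using assms(10) n by simp
    qed (use fin V z_refl z_sym nonneg adj_sym adj_irrefl inner_degree assms(7,8) out1 out2 balance
         in auto)
    \<comment> \<open>If the crossing mass vanished, balance would make the inner mass vanish too;
      nonnegativity then forces \<open>z\<close> to be zero and \<open>x\<close> to be the cut
      vector.\<close>
    have "B > 0"
    proof (rule ccontr)
      assume "\<not> B > 0"
      moreover have "B \<ge> 0"
        unfolding B_def using V(1) by (intro sum_nonneg nonneg) blast+
      ultimately have "B = 0"
        by linarith
      then have "(\<Sum>i\<in>V1 \<union> V2. \<Sum>j\<in>V1 \<union> V2. z i j) = 0"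
        using double_sum_union[OF fin V(2), of z] z_sym balance by (simp add: B_def)
      then have "\<forall>i\<in>{1..n}. (\<Sum>j\<in>{1..n}. z i j) = 0"
        unfolding V(1) using nonneg by (subst (asm) sum_nonneg_eq_0_iff) (auto intro!: sum_nonneg)
      then have z0: "z i j = 0" if "i \<in> {1..n}" "j \<in> {1..n}" for i j
        using that nonneg sum_nonneg_eq_0_iff[of "{1..n}" "z i"] by simp
      have "x p = ?c p" if "p \<in> pairs n" for p
      proof -
        obtain i j where p: "p = (i, j)"
          by fastforce
        have "z i j = 0"
          using that p z0 by (auto simp: pairs_def)
        then have "coord x i j = coord ?c i j"
          using D[of i j] that p by (simp add: D_def split: if_splits)
        then show ?thesis
          using that p by (simp add: coord_def pairs_def)
      qed
      \<comment> \<open>Both functions are \<open>undefined\<close> off \<open>pairs n\<close>, so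
        agreement on the index set suffices for equality.\<close>
      moreover have "x \<in> pairs n \<rightarrow>\<^sub>E UNIV" "?c \<in> pairs n \<rightarrow>\<^sub>E UNIV"
        using x feasible_cut by (auto simp: lp_feasible_def pair_vectors_def)
      ultimately have "x = ?c"
        by (intro PiE_ext) auto
      with neq show False
        by contradiction
    qed
    with gap have "0 < real (card V1) * (2 * (lp_objective n E x - lp_objective n E ?c))"
      by linarith
    then show ?thesis
      by (simp add: zero_less_mult_iff)
  qed
  show ?thesis
    unfolding lp_recovers_def lp_optimal_def is_arg_min_def
    using strict feasible_cut by (metis order.asym)
qed

end
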